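(* Let the stage cost $\ell:\mathcal{U}\to\mathbb{R}$ be continuous and strictly convex. For any $\gamma>0$, if $\varepsilon$ in the modified steady-state problem is chosen as $\varepsilon=\min\{\gamma,\gamma/R\}$, where $R=\max_{x\in\mathcal{X}}x^\top x$, and the solution $(x^s_\varepsilon,u^s_\varepsilon)$ of the modified steady-state problem is unique, then $$\ell(u^s_\varepsilon)-\ell^s\le\gamma.$$
   Context: $\mathcal{X}\subseteq\mathbb{R}^n$ and $\mathcal{U}\subseteq\mathbb{R}^m$ are compact and convex, $f:\mathcal{X}\times\mathcal{U}\to\mathbb{R}^n$. Steady-state problem: minimise $\ell(u)$ over $(x,u)\in\mathcal{X}\times\mathcal{U}$ subject to $x=f(x,u)$. It is assumed to have at least one solution; its optimal value is $\ell^s$. Modified steady-state problem: for $\varepsilon>0$, minimise $\ell(u)+\varepsilon x^\top x$ over $(x,u)\in\mathcal{X}\times\mathcal{U}$ subject to $x=f(x,u)$; its solution is denoted $(x^s_\varepsilon,u^s_\varepsilon)$. Convention: if $R=0$ then $\min\{\gamma,\gamma/R\}$ is read as $\gamma$. *)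

theory Defs
  imports "HOL-Analysis.Analysis"
begin

definition strictly_convex_on :: "'a::real_vector set \<Rightarrow> ('a \<Rightarrow> real) \<Rightarrow> bool" where
  "strictly_convex_on S g \<longleftrightarrow> convex S \<and>
     (\<forall>t x y. 0 < t \<longrightarrow> t < 1 \<longrightarrow> x \<in> S \<longrightarrow> y \<in> S \<longrightarrow> x \<noteq> y \<longrightarrow>
        g ((1 - t) *\<^sub>R x + t *\<^sub>R y) < (1 - t) * g x + t * g y)"

definition steady_states ::
    "(real ^ 'n) set \<Rightarrow> (real ^ 'm) set \<Rightarrow> ((real ^ 'n) \<times> (real ^ 'm) \<Rightarrow> real ^ 'n)
      \<Rightarrow> ((real ^ 'n) \<times> (real ^ 'm)) set" where
  "steady_states X U f = {(x, u). x \<in> X \<and> u \<in> U \<and> x = f (x, u)}"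

definition steady_state_solution ::
    "(real ^ 'n) set \<Rightarrow> (real ^ 'm) set \<Rightarrow> ((real ^ 'n) \<times> (real ^ 'm) \<Rightarrow> real ^ 'n)
      \<Rightarrow> (real ^ 'm \<Rightarrow> real) \<Rightarrow> (real ^ 'n) \<times> (real ^ 'm) \<Rightarrow> bool" where
  "steady_state_solution X U f l z \<longleftrightarrow>
     is_arg_min (\<lambda>(x, u). l u) (\<lambda>w. w \<in> steady_states X U f) z"

text \<open>An infimum over the reals is meaningful only for a nonempty set bounded below; both hold
  whenever the steady-state problem has a solution, and the infimum is then attained.\<close>

definition steady_state_value ::
    "(real ^ 'n) set \<Rightarrow> (real ^ 'm) set \<Rightarrow> ((real ^ 'n) \<times> (real ^ 'm) \<Rightarrow> real ^ 'n)
      \<Rightarrow> (real ^ 'm \<Rightarrow> real) \<Rightarrow> real" where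
  "steady_state_value X U f l = (INF (x, u) \<in> steady_states X U f. l u)"

definition modified_steady_state_solution ::
    "(real ^ 'n) set \<Rightarrow> (real ^ 'm) set \<Rightarrow> ((real ^ 'n) \<times> (real ^ 'm) \<Rightarrow> real ^ 'n)
      \<Rightarrow> (real ^ 'm \<Rightarrow> real) \<Rightarrow> real \<Rightarrow> (real ^ 'n) \<times> (real ^ 'm) \<Rightarrow> bool" where
  "modified_steady_state_solution X U f l \<epsilon> z \<longleftrightarrow>
     is_arg_min (\<lambda>(x, u). l u + \<epsilon> * (x \<bullet> x)) (\<lambda>w. w \<in> steady_states X U f) z"

definition max_sq_norm :: "(real ^ 'n) set \<Rightarrow> real" where
  "max_sq_norm X = (GREATEST r. r \<in> (\<lambda>x. x \<bullet> x) ` X)"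

text \<open>The case distinction matters: division by zero yields zero, so the minimum alone would
  give zero instead of \<open>\<gamma>\<close> when \<open>R = 0\<close>.\<close>

definition regularization_weight :: "real \<Rightarrow> real \<Rightarrow> real" where
  "regularization_weight \<gamma> R = (if R = 0 then \<gamma> else min \<gamma> (\<gamma> / R))"

end

theory Submission
  imports Defs
begin

text \<open>Both problems have the same feasible set, so an optimal pair (x, u) of the original
  problem may be tested against the modified optimum. With R the maximal squared norm on
  \<open>X\<close>, dropping the nonnegative penalty on the left and bounding it by
  \<open>\<epsilon>\<close> * R on the right gives l(u_\<epsilon>) \<le> l(u) +
  \<open>\<epsilon>\<close> * R. Here l(u) is the optimal value by
  \<open>steady_state_value_eq\<close>, and the weight is chosen so that \<open>\<epsilon>\<close> *
  R \<le> \<gamma>, which is \<open>regularization_weight_mult_le\<close>.\<close>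

lemma sq_norm_le_max_sq_norm:
  fixes X :: "(real ^ 'n) set"
  assumes "compact X" "x \<in> X"
  shows "x \<bullet> x \<le> max_sq_norm X"
proof -
  \<comment> \<open>\<open>GREATEST\<close> denotes the maximum only once one is known to exist;
    compactness supplies it, and \<open>x\<close> shows that the image is nonempty.\<close>
  have "compact ((\<lambda>x. x \<bullet> x) ` X)"
    by (intro compact_continuous_image continuous_intros assms(1))
  then obtain m where m: "m \<in> (\<lambda>x. x \<bullet> x) ` X" "\<forall>r \<in> (\<lambda>x. x \<bullet> x) ` X. r \<le> m"
    using compact_attains_sup[of "(\<lambda>x. x \<bullet> x) ` X"] assms(2) by blast
  then have "max_sq_norm X = m"
    unfolding max_sq_norm_def by (intro Greatest_equality) auto
  with m(2) assms(2) show ?thesis by auto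
qed

text \<open>The infimum is attained at the solution, so it is a minimum. Since the reals are
  linearly ordered, "no feasible value is strictly smaller" becomes a lower bound.\<close>

lemma steady_state_value_eq:
  assumes "steady_state_solution X U f l (x, u)"
  shows "steady_state_value X U f l = l u"
  unfolding steady_state_value_def
proof (rule cInf_eq_minimum)
  show "l u \<in> (\<lambda>(x, u). l u) ` steady_states X U f"
    using assms by (force simp: steady_state_solution_def is_arg_min_def)
  show "l u \<le> r" if "r \<in> (\<lambda>(x, u). l u) ` steady_states X U f" for r
    using assms that by (force simp: steady_state_solution_def is_arg_min_linorder)
qed

lemma regularization_weight_nonneg:
  assumes "\<gamma> \<ge> 0" "R \<ge> 0"
  shows "regularization_weight \<gamma> R \<ge> 0"
  using assms by (simp add: regularization_weight_def)

text \<open>For nonzero R the weight is at most \<gamma> / R, and R cancels; for R = 0 the product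
  vanishes whatever the weight is.\<close>

lemma regularization_weight_mult_le:
  assumes "\<gamma> \<ge> 0" "R \<ge> 0"
  shows "regularization_weight \<gamma> R * R \<le> \<gamma>"
proof (cases "R = 0")
  case False
  then have "regularization_weight \<gamma> R * R \<le> \<gamma> / R * R"
    using assms by (intro mult_right_mono) (simp_all add: regularization_weight_def)
  with False show ?thesis by simp
qed (use assms in simp)

theorem lemma3:
  fixes X :: "(real ^ 'n) set"
    and U :: "(real ^ 'm) set"
    and f :: "(real ^ 'n) \<times> (real ^ 'm) \<Rightarrow> real ^ 'n"
    and l :: "real ^ 'm \<Rightarrow> real"
    and \<gamma> \<epsilon> :: real
    and x\<^sub>\<epsilon> :: "real ^ 'n"
    and u\<^sub>\<epsilon> :: "real ^ 'm"
  assumes "compact X" "convex X"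
    and "compact U" "convex U"
    and "\<exists>z. steady_state_solution X U f l z"
    and "continuous_on U l"
    and "strictly_convex_on U l"
    and "\<gamma> > 0"
    and "\<epsilon> = regularization_weight \<gamma> (max_sq_norm X)"
    and "modified_steady_state_solution X U f l \<epsilon> (x\<^sub>\<epsilon>, u\<^sub>\<epsilon>)"
    and "\<forall>z. modified_steady_state_solution X U f l \<epsilon> z \<longrightarrow> z = (x\<^sub>\<epsilon>, u\<^sub>\<epsilon>)"
  shows "l u\<^sub>\<epsilon> - steady_state_value X U f l \<le> \<gamma>"
proof -
  obtain x u where xu: "steady_state_solution X U f l (x, u)"
    using assms(5) by auto
  then have feasible: "(x, u) \<in> steady_states X U f"
    by (simp add: steady_state_solution_def is_arg_min_def)
  then have "x \<in> X"
    by (simp add: steady_states_def)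
  then have le_R: "x \<bullet> x \<le> max_sq_norm X"
    by (rule sq_norm_le_max_sq_norm[OF assms(1)])
  \<comment> \<open>The sign of the maximum is read off from the point \<open>x\<close>, which lies
    in \<open>X\<close>.\<close>
  then have R_nonneg: "max_sq_norm X \<ge> 0"
    using inner_ge_zero[of x] by linarith
  have \<epsilon>_nonneg: "\<epsilon> \<ge> 0"
    using assms(8,9) R_nonneg by (simp add: regularization_weight_nonneg)
  have "l u\<^sub>\<epsilon> \<le> l u\<^sub>\<epsilon> + \<epsilon> * (x\<^sub>\<epsilon> \<bullet> x\<^sub>\<epsilon>)"
    using \<epsilon>_nonneg by simp
  \<comment> \<open>Optimality for the modified problem, tested at the original solution (x,
    u).\<close>
  also have "\<dots> \<le> l u + \<epsilon> * (x \<bullet> x)"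
    using assms(10) feasible
    by (force simp: modified_steady_state_solution_def is_arg_min_linorder)
  also have "\<dots> \<le> l u + \<epsilon> * max_sq_norm X"
    using \<epsilon>_nonneg le_R by (simp add: mult_left_mono)
  also have "\<dots> \<le> l u + \<gamma>"
    using assms(8,9) R_nonneg by (simp add: regularization_weight_mult_le)
  finally show ?thesis
    by (simp add: steady_state_value_eq[OF xu])
qed

end
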